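(* Let $k$ be even and $f\in S_k(\mathrm{SL}(2,\mathbb Z))$, $f\not\equiv0$. Then the set $$A_f=\{z_0\in\mathbb H\cup\{\text{cusps}\}:\ c_{z_0}(f,n)=0\text{ for some non-trivial }n\}$$ has (Lebesgue) measure $0$.
   Context: $S_k(\Gamma)$ is the space of holomorphic cusp forms of weight $k$ for $\Gamma=\mathrm{SL}(2,\mathbb Z)$; the cusps are $\mathbb Q\cup\{\infty\}$. For $z_0=\alpha+i\beta\in\mathbb H$ let $\sigma_{z_0}=\frac{1}{2i\beta}\begin{pmatrix}-\overline{z_0}&z_0\\-1&1\end{pmatrix}$, $(f|_k\gamma)(z)=\det(\gamma)^{k/2}f(\gamma z)(cz+d)^{-k}$, and define $c_{z_0}(f,n)$ by $(f|_k\sigma_{z_0})(z)=\sum_{n\ge0}c_{z_0}(f,n)z^n$ on the unit disc. If $N$ is the order of the image in $\mathrm{PSL}(2,\mathbb Z)$ of the stabilizer of $z_0$, then $c_{z_0}(f,n)$ is called non-trivial when $n\equiv -k/2\bmod N$. For a cusp $z_0$, with $\sigma\in\mathrm{SL}(2,\mathbb R)$ a scaling matrix ($\sigma\infty=z_0$ and $\sigma^{-1}\gamma_0\sigma z=z+1$ for a generator $\gamma_0$ of the stabilizer), $c_{z_0}(f,n)$ are defined by $(f|_k\sigma)(z)=\sum_{n\ge1}c_{z_0}(f,n)e^{2\pi i nz}$, and all $n\ge1$ are non-trivial. *)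

theory Defs
  imports "HOL-Complex_Analysis.Complex_Analysis" "HOL-Number_Theory.Cong"
begin

definition upper_half_plane :: "complex set" where
  "upper_half_plane = {z. Im z > 0}"

text \<open>
  All matrices are complex $2 \times 2$ matrices; the row index comes first.
  The action is defined on the complex plane together with one point at infinity,
  so that points of the upper half-plane and cusps are treated alike.
\<close>

datatype ext_complex = Fin complex | Infty

definition aut_factor :: "complex^2^2 \<Rightarrow> complex \<Rightarrow> complex" where
  "aut_factor A z = A$2$1 * z + A$2$2"

definition moebius :: "complex^2^2 \<Rightarrow> complex \<Rightarrow> complex" where
  "moebius A z = (A$1$1 * z + A$1$2) / aut_factor A z"

fun moebius_ext :: "complex^2^2 \<Rightarrow> ext_complex \<Rightarrow> ext_complex" where
  "moebius_ext A (Fin z) = (if aut_factor A z = 0 then Infty else Fin (moebius A z))"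
| "moebius_ext A Infty = (if A$2$1 = 0 then Infty else Fin (A$1$1 / A$2$1))"

definition SL2Z :: "(complex^2^2) set" where
  "SL2Z = {A. (\<forall>i j. A$i$j \<in> \<int>) \<and> det A = 1}"

definition SL2R :: "(complex^2^2) set" where
  "SL2R = {A. (\<forall>i j. A$i$j \<in> \<real>) \<and> det A = 1}"

definition cusps :: "ext_complex set" where
  "cusps = insert Infty (Fin ` \<rat>)"

definition stabilizer :: "ext_complex \<Rightarrow> (complex^2^2) set" where
  "stabilizer x = {A \<in> SL2Z. moebius_ext A x = x}"

text \<open>
  The weight is an even integer wherever this is used, so the exponent
  $k/2$ of the determinant is an integer.
\<close>

definition slash :: "int \<Rightarrow> (complex \<Rightarrow> complex) \<Rightarrow> complex^2^2 \<Rightarrow> complex \<Rightarrow> complex" where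
  "slash k f A z = det A powi (k div 2) * f (moebius A z) * aut_factor A z powi (- k)"

text \<open>
  Only the values on the upper half-plane matter. Since all cusps are equivalent under
  the full modular group, the cusp condition is imposed at infinity only: the Fourier
  expansion there has no terms of index $\le 0$.
\<close>

definition cusp_form :: "int \<Rightarrow> (complex \<Rightarrow> complex) \<Rightarrow> bool" where
  "cusp_form k f \<longleftrightarrow>
     f holomorphic_on upper_half_plane \<and>
     (\<forall>A\<in>SL2Z. \<forall>z\<in>upper_half_plane. slash k f A z = f z) \<and>
     (\<exists>a :: nat \<Rightarrow> complex. a 0 = 0 \<and>
        (\<forall>z\<in>upper_half_plane. (\<lambda>n. a n * exp (2 * pi * \<i> * of_nat n * z)) sums f z))"


subsection \<open>Expansion at a point of the upper half-plane\<close>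

definition disc_matrix :: "complex \<Rightarrow> complex^2^2" where
  "disc_matrix z0 = (let w = 2 * \<i> * of_real (Im z0) in
     vector [vector [- cnj z0 / w, z0 / w], vector [- 1 / w, 1 / w]])"

definition point_coeff :: "int \<Rightarrow> (complex \<Rightarrow> complex) \<Rightarrow> complex \<Rightarrow> nat \<Rightarrow> complex" where
  "point_coeff k f z0 = (THE c. \<forall>z\<in>ball 0 1. (\<lambda>n. c n * z ^ n) sums slash k f (disc_matrix z0) z)"

text \<open>The class of \<open>A\<close> in PSL(2,Z) is \<open>{A, - A}\<close>.\<close>

definition stabilizer_order :: "complex \<Rightarrow> nat" where
  "stabilizer_order z0 = card ((\<lambda>A. {A, - A}) ` stabilizer (Fin z0))"

definition nontrivial_index :: "int \<Rightarrow> complex \<Rightarrow> nat \<Rightarrow> bool" where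
  "nontrivial_index k z0 n \<longleftrightarrow> [int n = - (k div 2)] (mod int (stabilizer_order z0))"


subsection \<open>Expansion at a cusp\<close>

definition matrix_power :: "complex^2^2 \<Rightarrow> nat \<Rightarrow> complex^2^2" where
  "matrix_power A m = (((**) A) ^^ m) (mat 1)"

text \<open>
  The stabilizer of a cusp contains \<open>- mat 1\<close>; a generator is meant modulo sign,
  that is, for the image of the stabilizer in PSL(2,Z).
\<close>

definition stabilizer_generator :: "complex^2^2 \<Rightarrow> ext_complex \<Rightarrow> bool" where
  "stabilizer_generator g x \<longleftrightarrow> g \<in> stabilizer x \<and>
     (\<forall>A\<in>stabilizer x. \<exists>m. A \<in> {matrix_power g m, - matrix_power g m} \<or>
                          matrix_inv A \<in> {matrix_power g m, - matrix_power g m})"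

definition scaling_matrix :: "complex^2^2 \<Rightarrow> ext_complex \<Rightarrow> bool" where
  "scaling_matrix S x \<longleftrightarrow> S \<in> SL2R \<and> moebius_ext S Infty = x \<and>
     (\<exists>g. stabilizer_generator g x \<and>
          (\<forall>z\<in>upper_half_plane. moebius (matrix_inv S ** g ** S) z = z + 1))"

text \<open>The requirement \<open>c 0 = 0\<close> encodes that the expansion starts at index 1.\<close>

definition cusp_coeff :: "int \<Rightarrow> (complex \<Rightarrow> complex) \<Rightarrow> complex^2^2 \<Rightarrow> nat \<Rightarrow> complex" where
  "cusp_coeff k f S = (THE c. c 0 = 0 \<and>
     (\<forall>z\<in>upper_half_plane. (\<lambda>n. c n * exp (2 * pi * \<i> * of_nat n * z)) sums slash k f S z))"


subsection \<open>Points with a vanishing non-trivial coefficient\<close>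

text \<open>
  The scaling matrix of a cusp is unique up to sign and up to a real translation on the
  right. Changing it multiplies the \<open>n\<close>-th coefficient by a factor
  $e^{2 \pi i n t}$ with $t$ real, so whether a coefficient vanishes does not depend on the choice.
\<close>

definition vanishing_points :: "int \<Rightarrow> (complex \<Rightarrow> complex) \<Rightarrow> ext_complex set" where
  "vanishing_points k f =
     {Fin z0 | z0. z0 \<in> upper_half_plane \<and>
        (\<exists>n. nontrivial_index k z0 n \<and> point_coeff k f z0 n = 0)} \<union>
     {x \<in> cusps. \<exists>S. scaling_matrix S x \<and> (\<exists>n\<ge>1. cusp_coeff k f S n = 0)}"

text \<open>
  Two-dimensional Lebesgue measure on the extended plane; the point at infinity has
  measure 0.
\<close>

definition ext_null_set :: "ext_complex set \<Rightarrow> bool" where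
  "ext_null_set A \<longleftrightarrow> {z. Fin z \<in> A} \<in> null_sets lebesgue"

end

theory Submission imports Defs
begin

text \<open>
  Up to a non-zero factor, the \<open>n\<close>-th coefficient at \<open>z0\<close> is a polynomial in \<open>Im z0\<close> whose
  coefficients are holomorphic in \<open>z0\<close>, with leading coefficient a multiple of the \<open>n\<close>-th
  derivative of \<open>f\<close>. That derivative does not vanish identically, since a periodic polynomial is
  constant and a constant cusp form is zero. On a horizontal line \<open>Im z0\<close> is constant, so the
  coefficient is the restriction of a holomorphic function, which for all but finitely many lines
  is not identically zero and hence has countably many zeros. By Fubini the zero set is null.
  There are only countably many \<open>n\<close> and countably many cusps.
\<close>

section \<open>Zero sets of polynomials in the imaginary part with holomorphic coefficients\<close>

text \<open>Supplies the \<open>fsigma\<close> premise of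
  \<open>holomorphic_countable_zeros\<close>: an open set is a countable union of closed
  boxes.\<close>

lemma open_imp_fsigma:
  fixes S :: "'a::euclidean_space set"
  assumes "open S"
  shows "fsigma S"
proof -
  obtain \<D> where \<D>: "countable \<D>" "\<And>X. X \<in> \<D> \<Longrightarrow> \<exists>a b. X = cbox a b" "\<Union>\<D> = S"
    using open_countable_Union_open_cbox[OF assms] by metis
  \<comment> \<open>Adding the empty set keeps the family non-empty even for \<open>S = {}\<close>,
    as an enumeration by \<open>nat\<close> requires.\<close>
  define F where "F = from_nat_into (insert {} \<D>)"
  have range_F: "range F = insert {} \<D>"
    using \<D>(1) by (simp add: F_def range_from_nat_into)
  have "closed (F n)" for n
  proof -
    have "F n \<in> insert {} \<D>"
      using range_F by blast
    with \<D>(2) show ?thesis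
      by (metis closed_cbox closed_empty insert_iff)
  qed
  then have "fsigma (\<Union>(range F))"
    by (rule fsigma.intros)
  with range_F \<D>(3) show ?thesis
    by simp
qed

text \<open>For fixed \<open>y\<close>, replacing \<open>Im z\<close> by \<open>y\<close> gives a
  function that is holomorphic on all of \<open>S\<close> and agrees with the given one on the line
  \<open>Im z = y\<close>. Whether it vanishes identically can therefore be tested at
  \<open>z1\<close>, whichever line \<open>z1\<close> lies on.\<close>

lemma negligible_zeros_polynomial_in_Im:
  fixes h :: "nat \<Rightarrow> complex \<Rightarrow> complex"
  assumes hol: "\<And>r. r \<le> n \<Longrightarrow> h r holomorphic_on S"
    and S: "open S" "connected S" and m: "m \<le> n"
    and z1: "z1 \<in> S" "h m z1 \<noteq> 0"
  shows "negligible {z \<in> S. (\<Sum>r\<le>n. h r z * of_real (Im z) ^ r) = 0}"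
proof -
  \<comment> \<open>The imaginary part comes first, so that slicing a set of pairs at its first
    component yields horizontal lines.\<close>
  define \<phi> :: "real \<times> real \<Rightarrow> complex" where "\<phi> = (\<lambda>(y, x). Complex x y)"
  define G where "G = (\<lambda>z. \<Sum>r\<le>n. h r z * of_real (Im z) ^ r)"
  define A where "A = {p. \<phi> p \<in> S \<and> G (\<phi> p) = 0}"
  have \<phi>_eq: "\<phi> = (\<lambda>p. of_real (snd p) + \<i> * of_real (fst p))"
    by (auto simp: \<phi>_def complex_eq_iff)
  have cont_\<phi>: "continuous_on T \<phi>" for T
    unfolding \<phi>_eq by (intro continuous_intros)
  have contG: "continuous_on S G"
    unfolding G_def
    by (intro continuous_intros holomorphic_on_imp_continuous_on hol) auto
  have "open {z \<in> S. G z \<noteq> 0}"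
    using continuous_open_preimage[OF contG S(1), of "- {0}"]
    by (simp add: vimage_def Int_def open_Compl)
  then have "open (\<phi> -` S)" "open (\<phi> -` {z \<in> S. G z \<noteq> 0})"
    using S(1) cont_\<phi>[of UNIV] by (blast intro: open_vimage)+
  moreover have "A = \<phi> -` S - \<phi> -` {z \<in> S. G z \<noteq> 0}"
    by (auto simp: A_def)
  ultimately have A_borel: "A \<in> sets borel"
    by simp
  then have A_sets: "A \<in> sets (lborel \<Otimes>\<^sub>M lborel)"
    by (simp only: lborel_prod sets_lborel)
  \<comment> \<open>The exceptional heights: real roots of a polynomial that is non-zero because its
    coefficient \<open>h m z1\<close> is.\<close>
  define B where "B = {y :: real. (\<Sum>r\<le>n. h r z1 * of_real y ^ r) = 0}"
  have "finite {w. (\<Sum>r\<le>n. h r z1 * w ^ r) = 0}"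
    using polyfun_finite_roots[of "\<lambda>r. h r z1" n] m z1(2) by blast
  from finite_vimageI[OF this, of complex_of_real] have "finite B"
    by (simp add: B_def vimage_def inj_def)
  have slice: "countable (Pair y -` A)" if "y \<notin> B" for y
  proof -
    define g where "g = (\<lambda>z. \<Sum>r\<le>n. h r z * of_real y ^ r)"
    have "g z1 \<noteq> 0"
      using that by (simp add: B_def g_def)
    have "g holomorphic_on S"
      unfolding g_def by (intro holomorphic_intros hol) auto
    have "countable {z \<in> S. g z = 0}"
    proof (cases "g constant_on S")
      case True
      with \<open>g z1 \<noteq> 0\<close> z1(1) have "{z \<in> S. g z = 0} = {}"
        by (auto simp: constant_on_def)
      then show ?thesis
        by (simp only: countable_empty)
    next
      case False
      with \<open>g holomorphic_on S\<close> S show ?thesis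
        by (intro holomorphic_countable_zeros) (auto simp: open_imp_fsigma)
    qed
    moreover have "(\<lambda>x. Complex x y) ` (Pair y -` A) \<subseteq> {z \<in> S. g z = 0}"
      by (auto simp: A_def G_def g_def \<phi>_def)
    ultimately have "countable ((\<lambda>x. Complex x y) ` (Pair y -` A))"
      by (rule countable_subset[rotated])
    then show ?thesis
      by (rule countable_image_inj_on) (auto simp: inj_on_def)
  qed
  have "AE y in lborel. y \<notin> B"
    using \<open>finite B\<close> by (intro AE_not_in finite_imp_null_set_lborel)
  then have "AE y in lborel. emeasure lborel (Pair y -` A) = 0"
    by eventually_elim (use slice emeasure_lborel_countable in blast)
  from nn_integral_cong_AE[OF this]
  have "(\<integral>\<^sup>+ y. emeasure lborel (Pair y -` A) \<partial>lborel) = 0"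
    by simp
  then have "emeasure (lborel \<Otimes>\<^sub>M lborel) A = 0"
    using lborel.emeasure_pair_measure_alt[OF A_sets] by simp
  then have "A \<in> null_sets lborel"
    using A_borel by (simp add: null_sets_def lborel_prod)
  then have "negligible A"
    by (simp add: negligible_iff_null_sets null_sets_completionI)
  \<comment> \<open>A differentiable map between spaces of equal dimension carries negligible sets
    to negligible sets; this moves the result from pairs of reals to the complex plane.\<close>
  moreover have "\<phi> differentiable_on A"
    unfolding \<phi>_eq differentiable_on_def differentiable_def
    by (intro ballI exI) (auto intro!: derivative_eq_intros)
  ultimately have "negligible (\<phi> ` A)"
    by (intro negligible_differentiable_image_negligible) auto
  moreover have "{z \<in> S. G z = 0} \<subseteq> \<phi> ` A"
  proof
    fix z assume "z \<in> {z \<in> S. G z = 0}"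
    then have "z = \<phi> (Im z, Re z)" "(Im z, Re z) \<in> A"
      by (auto simp: A_def \<phi>_def)
    then show "z \<in> \<phi> ` A" by blast
  qed
  ultimately show ?thesis
    unfolding G_def by (rule negligible_subset)
qed

section \<open>Derivatives of a non-zero cusp form\<close>

lemma open_upper_half_plane: "open upper_half_plane"
  unfolding upper_half_plane_def by (rule open_halfspace_Im_gt)

lemma connected_upper_half_plane: "connected upper_half_plane"
  unfolding upper_half_plane_def by (intro convex_connected convex_halfspace_Im_gt)

lemma upper_half_plane_plus_1: "z + 1 \<in> upper_half_plane \<longleftrightarrow> z \<in> upper_half_plane"
  by (simp add: upper_half_plane_def)

text \<open>Induction on \<open>n\<close>: the derivative is again periodic, hence constant by the
  induction hypothesis, so \<open>f\<close> is affine, and periodicity forces its slope to be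
  0.\<close>

lemma periodic_higher_deriv_zero_imp_constant:
  assumes "f holomorphic_on upper_half_plane"
    and "\<And>z. z \<in> upper_half_plane \<Longrightarrow> f (z + 1) = f z"
    and "\<And>z. z \<in> upper_half_plane \<Longrightarrow> (deriv ^^ n) f z = 0"
  shows "f constant_on upper_half_plane"
  using assms
proof (induction n arbitrary: f)
  case 0
  then show ?case by (auto simp: constant_on_def)
next
  case (Suc n)
  note op = open_upper_half_plane
  have deriv_f: "(f has_field_derivative deriv f z) (at z)" if "z \<in> upper_half_plane" for z
    using Suc.prems(1) op that by (rule holomorphic_derivI)
  have "deriv f constant_on upper_half_plane"
  proof (rule Suc.IH)
    show "deriv f holomorphic_on upper_half_plane"
      using Suc.prems(1) op by (rule holomorphic_deriv)
    show "(deriv ^^ n) (deriv f) z = 0" if "z \<in> upper_half_plane" for z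
      using Suc.prems(3)[OF that] by (simp add: funpow_swap1)
    show "deriv f (z + 1) = deriv f z" if "z \<in> upper_half_plane" for z
    proof -
      have "((\<lambda>z. f (z + 1)) has_field_derivative deriv f (z + 1)) (at z)"
        using deriv_f[of "z + 1"] that by (simp add: upper_half_plane_plus_1 DERIV_shift)
      then have "(f has_field_derivative deriv f (z + 1)) (at z)"
        by (rule has_field_derivative_transform_within_open[OF _ op that])
           (use Suc.prems(2) in auto)
      then show ?thesis
        using deriv_f[OF that] by (rule DERIV_unique)
    qed
  qed
  then obtain c where c: "\<And>z. z \<in> upper_half_plane \<Longrightarrow> deriv f z = c"
    by (auto simp: constant_on_def)
  have "(\<lambda>z. f z - c * z) constant_on upper_half_plane"
  proof (rule has_field_derivative_0_imp_constant_on[OF _ connected_upper_half_plane op])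
    show "((\<lambda>z. f z - c * z) has_field_derivative 0) (at z)" if "z \<in> upper_half_plane" for z
      using deriv_f[OF that] c[OF that] by (auto intro!: derivative_eq_intros)
  qed
  then obtain b where b: "\<And>z. z \<in> upper_half_plane \<Longrightarrow> f z - c * z = b"
    by (auto simp: constant_on_def)
  have "\<i> \<in> upper_half_plane"
    by (simp add: upper_half_plane_def)
  with b[of "\<i> + 1"] b[of \<i>] Suc.prems(2)[of \<i>] have "c = 0"
    by (simp add: upper_half_plane_plus_1 algebra_simps)
  with b show ?case
    by (auto simp: constant_on_def)
qed

text \<open>Read off the Fourier expansion, whose terms all have period 1.\<close>

lemma cusp_form_periodic:
  assumes "cusp_form k f" "z \<in> upper_half_plane"
  shows "f (z + 1) = f z"
proof -
  obtain a where a: "\<And>z. z \<in> upper_half_plane \<Longrightarrow>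
      (\<lambda>n. a n * exp (2 * pi * \<i> * of_nat n * z)) sums f z"
    using assms(1) unfolding cusp_form_def by blast
  have "exp (2 * pi * \<i> * of_nat n * (z + 1)) = exp (2 * pi * \<i> * of_nat n * z)" for n
  proof -
    have "2 * pi * \<i> * of_nat n * (z + 1) = 2 * pi * \<i> * of_nat n * z + 2 * of_nat n * pi * \<i>"
      by (simp add: algebra_simps)
    then show ?thesis
      using exp_integer_2pi[of "of_nat n"] by (simp only: exp_add) simp
  qed
  then show ?thesis
    using a[of "z + 1"] a[of z] assms(2) sums_unique2 by (simp add: upper_half_plane_plus_1)
qed

text \<open>In the variable \<open>q = exp (2 * pi * \<i> * z)\<close> the Fourier expansion is a
  power series on the punctured unit disc. If its sum is constantly \<open>c\<close>, letting
  \<open>q\<close> tend to 0 gives \<open>c = a 0 = 0\<close>.\<close>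

lemma cusp_form_constant_imp_zero:
  assumes "cusp_form k f" and c: "\<And>z. z \<in> upper_half_plane \<Longrightarrow> f z = c"
  shows "c = 0"
proof -
  obtain a where a0: "a 0 = 0" and a: "\<And>z. z \<in> upper_half_plane \<Longrightarrow>
      (\<lambda>n. a n * exp (2 * pi * \<i> * of_nat n * z)) sums f z"
    using assms(1) unfolding cusp_form_def by blast
  have "(\<lambda>n. a n * q ^ n) sums c" if q: "q \<noteq> 0" "norm q < 1" for q
  proof -
    \<comment> \<open>A preimage of \<open>q\<close> under the exponential above;
      \<open>norm q < 1\<close> puts it in the upper half-plane.\<close>
    define z where "z = Ln q / (2 * pi * \<i>)"
    have "Im z = - ln (norm q) / (2 * pi)"
      using q by (simp add: z_def Im_divide power2_eq_square)
    then have "Im z > 0"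
      using q by (simp add: divide_neg_pos)
    then have z: "z \<in> upper_half_plane"
      by (simp add: upper_half_plane_def)
    have "exp (2 * pi * \<i> * of_nat n * z) = q ^ n" for n
    proof -
      have "2 * pi * \<i> * of_nat n * z = of_nat n * Ln q"
        by (simp add: z_def)
      then show ?thesis
        using q by (simp only: exp_of_nat_mult exp_Ln not_False_eq_True)
    qed
    with a[OF z] c[OF z] show ?thesis
      by simp
  qed
  then have "((\<lambda>_. c) \<longlongrightarrow> a 0) (at (0::complex))"
    by (rule powser_limit_0_strong[OF zero_less_one])
  then show ?thesis
    using a0 by (simp add: tendsto_const_iff)
qed

lemma cusp_form_higher_deriv_nonzero:
  assumes "cusp_form k f" "\<exists>z\<in>upper_half_plane. f z \<noteq> 0"
  shows "\<exists>z\<in>upper_half_plane. (deriv ^^ n) f z \<noteq> 0"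
proof (rule ccontr)
  assume "\<not> ?thesis"
  then have "f constant_on upper_half_plane"
    using assms(1) cusp_form_periodic[OF assms(1)]
    by (intro periodic_higher_deriv_zero_imp_constant[of f n]) (auto simp: cusp_form_def)
  then obtain c where "\<And>z. z \<in> upper_half_plane \<Longrightarrow> f z = c"
    by (auto simp: constant_on_def)
  with cusp_form_constant_imp_zero[OF assms(1) this] assms(2) show False
    by auto
qed

section \<open>Taylor coefficients at a point of the upper half-plane\<close>

text \<open>
  The recursion comes from differentiating
  \<open>(1 - u) powi (- k - n - r) * (deriv ^^ r) f (M u)\<close> for
  \<open>M u = (z0 - cnj z0 * u) / (1 - u)\<close>, whose derivative is
  \<open>(z0 - cnj z0) / (1 - u)\<^sup>2\<close>.
\<close>

primrec disc_coeff :: "int \<Rightarrow> nat \<Rightarrow> nat \<Rightarrow> complex" where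
  "disc_coeff k 0 r = (if r = 0 then 1 else 0)"
| "disc_coeff k (Suc n) r = of_int (k + int n + int r) * disc_coeff k n r +
     (if r = 0 then 0 else disc_coeff k n (r - 1))"

lemma disc_coeff_eq_0: "n < r \<Longrightarrow> disc_coeff k n r = 0"
  by (induction n arbitrary: r) auto

text \<open>Makes the coefficient of the \<open>n\<close>-th power of \<open>Im z0\<close> a
  non-zero multiple of the \<open>n\<close>-th derivative of \<open>f\<close>. On the diagonal the
  first summand of the recursion is zero and the second copies the previous diagonal entry.\<close>

lemma disc_coeff_diag: "disc_coeff k n n = 1"
  by (induction n) (auto simp: disc_coeff_eq_0)

text \<open>The map is the Cayley transform given by \<open>disc_matrix z0\<close>, which sends 0 to
  \<open>z0\<close>.\<close>

lemma disc_to_upper_half_plane: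
  assumes "z0 \<in> upper_half_plane" "norm u < 1"
  shows "(z0 - cnj z0 * u) / (1 - u) \<in> upper_half_plane"
proof -
  have "u \<noteq> 1"
    using assms(2) by auto
  have "Im ((z0 - cnj z0 * u) / (1 - u)) = Im z0 * (1 - (norm u)\<^sup>2) / (norm (1 - u))\<^sup>2"
    by (simp add: Im_divide cmod_power2) (simp add: power2_eq_square algebra_simps)
  moreover have "(norm u)\<^sup>2 < 1"
    using assms(2) by (simp add: power_less_one_iff)
  ultimately show ?thesis
    using assms(1) \<open>u \<noteq> 1\<close> by (simp add: upper_half_plane_def)
qed

text \<open>Induction on \<open>n\<close>. Differentiating the power of \<open>1 - u\<close> keeps
  \<open>r\<close> and lowers the exponent by 1; differentiating the derivative of \<open>f\<close>
  raises \<open>r\<close> by 1 and, by the chain rule, lowers the exponent by 2. Both outcomes fit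
  the exponent for \<open>Suc n\<close>.\<close>

lemma higher_deriv_disc_expansion:
  assumes f: "f holomorphic_on upper_half_plane" and z0: "z0 \<in> upper_half_plane"
    and u: "norm u < 1"
  defines "M \<equiv> \<lambda>u. (z0 - cnj z0 * u) / (1 - u)"
  shows "(deriv ^^ n) (\<lambda>u. f (M u) * (1 - u) powi (- k)) u =
    (\<Sum>r\<le>n. disc_coeff k n r * (z0 - cnj z0) ^ r * (deriv ^^ r) f (M u) *
       (1 - u) powi (- k - int n - int r))"
  using u
proof (induction n arbitrary: u)
  case 0
  then show ?case by simp
next
  case (Suc n)
  define w where "w = z0 - cnj z0"
  have "u \<noteq> 1"
    using Suc.prems by auto
  have Mu: "M u \<in> upper_half_plane"
    unfolding M_def by (rule disc_to_upper_half_plane[OF z0 Suc.prems])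
  have dM: "(M has_field_derivative w * (1 - u) powi (- 2)) (at u)"
    unfolding M_def using \<open>u \<noteq> 1\<close>
    by (auto intro!: derivative_eq_intros simp: w_def power_int_minus field_simps power2_eq_square)
  have df: "((\<lambda>u. (deriv ^^ r) f (M u)) has_field_derivative
      (deriv ^^ Suc r) f (M u) * (w * (1 - u) powi (- 2))) (at u)" for r
  proof -
    have "((deriv ^^ r) f has_field_derivative (deriv ^^ Suc r) f (M u)) (at (M u))"
      using holomorphic_derivI[OF holomorphic_higher_deriv[OF f open_upper_half_plane]
        open_upper_half_plane Mu] by simp
    then show ?thesis
      using dM by (rule DERIV_chain2)
  qed
  have dpow: "((\<lambda>u. (1 - u) powi e) has_field_derivative - of_int e * (1 - u) powi (e - 1)) (at u)"
    for e
    using \<open>u \<noteq> 1\<close> by (auto intro!: derivative_eq_intros)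
  \<comment> \<open>The \<open>r\<close>-th term of the sum for \<open>Suc n\<close>, without its
    coefficient \<open>disc_coeff k (Suc n) r\<close>.\<close>
  define t where "t = (\<lambda>r. w ^ r * (deriv ^^ r) f (M u) * (1 - u) powi (- k - int (Suc n) - int r))"
  have deriv_summand: "((\<lambda>u. disc_coeff k n r * w ^ r * (deriv ^^ r) f (M u) *
       (1 - u) powi (- k - int n - int r)) has_field_derivative
      of_int (k + int n + int r) * disc_coeff k n r * t r + disc_coeff k n r * t (Suc r)) (at u)" for r
  proof -
    define e where "e = - k - int n - int r"
    define P where "P = (1 - u) powi (- k - int (Suc n) - int (Suc r))"
    define Q where "Q = (1 - u) powi (e - 1)"
    have P: "(1 - u) powi (- 2) * (1 - u) powi e = P"
      using \<open>u \<noteq> 1\<close> by (simp add: P_def e_def algebra_simps flip: power_int_add)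
    have e: "e - 1 = - k - int (Suc n) - int r"
      by (simp add: e_def)
    have "((\<lambda>u. disc_coeff k n r * w ^ r * ((deriv ^^ r) f (M u) * (1 - u) powi e))
      has_field_derivative disc_coeff k n r * w ^ r *
       ((deriv ^^ Suc r) f (M u) * (w * (1 - u) powi (- 2)) * (1 - u) powi e +
        - of_int e * Q * (deriv ^^ r) f (M u))) (at u)"
      unfolding Q_def by (intro DERIV_cmult DERIV_mult df dpow)
    also have "(deriv ^^ Suc r) f (M u) * (w * (1 - u) powi (- 2)) * (1 - u) powi e =
        w * (deriv ^^ Suc r) f (M u) * P"
      by (simp only: mult_ac flip: P)
    also have "disc_coeff k n r * w ^ r * (w * (deriv ^^ Suc r) f (M u) * P +
        - of_int e * Q * (deriv ^^ r) f (M u)) =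
      of_int (k + int n + int r) * disc_coeff k n r * t r + disc_coeff k n r * t (Suc r)"
    proof -
      have "t r = w ^ r * (deriv ^^ r) f (M u) * Q" "t (Suc r) = w * w ^ r * (deriv ^^ Suc r) f (M u) * P"
        by (simp_all only: t_def Q_def P_def e power_Suc)
      then show ?thesis
        by (simp add: e_def algebra_simps del: funpow.simps)
    qed
    finally show ?thesis
      by (simp only: e_def mult.assoc)
  qed
  \<comment> \<open>The induction hypothesis is an identity on the whole open disc, so it may be
    differentiated at \<open>u\<close>.\<close>
  have "((deriv ^^ n) (\<lambda>u. f (M u) * (1 - u) powi (- k)) has_field_derivative
      (\<Sum>r\<le>n. of_int (k + int n + int r) * disc_coeff k n r * t r + disc_coeff k n r * t (Suc r)))
      (at u)"
  proof (rule has_field_derivative_transform_within_open)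
    show "((\<lambda>u. \<Sum>r\<le>n. disc_coeff k n r * w ^ r * (deriv ^^ r) f (M u) *
       (1 - u) powi (- k - int n - int r)) has_field_derivative
      (\<Sum>r\<le>n. of_int (k + int n + int r) * disc_coeff k n r * t r + disc_coeff k n r * t (Suc r)))
      (at u)"
      by (intro DERIV_sum deriv_summand)
    show "open (ball 0 1 :: complex set)" "u \<in> ball 0 1"
      using Suc.prems by auto
  qed (simp add: Suc.IH w_def)
  then have "(deriv ^^ Suc n) (\<lambda>u. f (M u) * (1 - u) powi (- k)) u =
      (\<Sum>r\<le>n. of_int (k + int n + int r) * disc_coeff k n r * t r) +
      (\<Sum>r\<le>n. disc_coeff k n r * t (Suc r))"
    by (simp add: DERIV_imp_deriv sum.distrib)
  \<comment> \<open>Both sums are brought to the range up to \<open>Suc n\<close>, the first by a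
    zero term and the second by an index shift; adding them termwise then gives the recursion of
    \<open>disc_coeff\<close>.\<close>
  also have "(\<Sum>r\<le>n. of_int (k + int n + int r) * disc_coeff k n r * t r) =
      (\<Sum>r\<le>Suc n. of_int (k + int n + int r) * disc_coeff k n r * t r)"
    by (simp add: disc_coeff_eq_0)
  also have "(\<Sum>r\<le>n. disc_coeff k n r * t (Suc r)) =
      (\<Sum>r\<le>Suc n. (if r = 0 then 0 else disc_coeff k n (r - 1)) * t r)"
    by (subst sum.atMost_Suc_shift) simp
  also have "(\<Sum>r\<le>Suc n. of_int (k + int n + int r) * disc_coeff k n r * t r) + \<dots> =
      (\<Sum>r\<le>Suc n. disc_coeff k (Suc n) r * t r)"
    by (simp add: sum.distrib[symmetric] distrib_right del: sum.atMost_Suc)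
  finally show ?case
    by (simp add: t_def w_def mult.assoc del: disc_coeff.simps funpow.simps sum.atMost_Suc)
qed

text \<open>Convergence near 0 makes the series the formal power series expansion of
  \<open>g\<close>, whose coefficients are the Taylor coefficients.\<close>

lemma power_series_coeffs_unique:
  fixes c :: "nat \<Rightarrow> complex"
  assumes "0 < R" and "\<And>z. z \<in> ball 0 R \<Longrightarrow> (\<lambda>n. c n * z ^ n) sums g z"
  shows "c n = (deriv ^^ n) g 0 / fact n"
proof -
  have "eventually (\<lambda>z. z \<in> ball 0 R) (nhds (0::complex))"
    using assms(1) by (intro eventually_nhds_in_open) auto
  then have "eventually (\<lambda>z. (\<lambda>n. fps_nth (Abs_fps c) n * z ^ n) sums g z) (nhds 0)"
    by eventually_elim (use assms(2) in simp)
  from has_fps_expansionI[OF this] show ?thesis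
    using fps_nth_fps_expansion[of g "Abs_fps c" n] by simp
qed

text \<open>With \<open>w = z0 - cnj z0\<close>, the determinant is \<open>1 / w\<close> and the
  automorphy factor is \<open>(1 - u) / w\<close>; their powers of \<open>1 / w\<close> combine into
  a constant that is non-zero and so does not affect vanishing.\<close>

lemma slash_disc_matrix:
  assumes "z0 \<in> upper_half_plane" "norm u < 1"
  shows "slash k f (disc_matrix z0) u =
    (1 / (z0 - cnj z0)) powi (k div 2 - k) *
      (f ((z0 - cnj z0 * u) / (1 - u)) * (1 - u) powi (- k))"
proof -
  define w where "w = z0 - cnj z0"
  have w: "2 * \<i> * of_real (Im z0) = w" "w \<noteq> 0"
    using assms(1) by (auto simp: w_def complex_eq_iff upper_half_plane_def)
  have "u \<noteq> 1"
    using assms(2) by auto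
  have disc: "disc_matrix z0 = vector [vector [- cnj z0 / w, z0 / w], vector [- 1 / w, 1 / w]]"
    by (simp only: disc_matrix_def Let_def w(1))
  have "det (disc_matrix z0) = (z0 - cnj z0) / (w * w)"
    using w(2) by (simp add: det_2 disc field_simps)
  then have det: "det (disc_matrix z0) = 1 / w"
    using w(2) by (simp add: w_def)
  have aut: "aut_factor (disc_matrix z0) u = 1 / w * (1 - u)"
    by (simp add: aut_factor_def disc diff_divide_distrib)
  have moeb: "moebius (disc_matrix z0) u = (z0 - cnj z0 * u) / (1 - u)"
    using w(2) \<open>u \<noteq> 1\<close>
    by (simp add: moebius_def aut) (simp add: disc field_simps)
  have "(1 / w) powi (k div 2 - k) = (1 / w) powi (k div 2) * (1 / w) powi (- k)"
    using w(2) by (simp flip: power_int_add)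
  then show ?thesis
    by (simp only: slash_def det aut moeb power_int_mult_distrib mult_ac flip: w_def)
qed

text \<open>At \<open>u = 0\<close> all powers of \<open>1 - u\<close> are 1 and the Cayley
  transform takes the value \<open>z0\<close>. Writing \<open>z0 - cnj z0\<close> as
  \<open>2 * \<i> * of_real (Im z0)\<close> confines the non-holomorphic dependence on
  \<open>z0\<close> to powers of \<open>Im z0\<close>.\<close>

lemma point_coeff_eq_0_iff:
  assumes f: "f holomorphic_on upper_half_plane" and z0: "z0 \<in> upper_half_plane"
  shows "point_coeff k f z0 n = 0 \<longleftrightarrow>
    (\<Sum>r\<le>n. disc_coeff k n r * (2 * \<i>) ^ r * (deriv ^^ r) f z0 * of_real (Im z0) ^ r) = 0"
proof -
  define C where "C = (1 / (z0 - cnj z0)) powi (k div 2 - k)"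
  define M where "M = (\<lambda>u. (z0 - cnj z0 * u) / (1 - u))"
  define F where "F = (\<lambda>u. f (M u) * (1 - u) powi (- k))"
  define g where "g = slash k f (disc_matrix z0)"
  have "z0 \<noteq> cnj z0"
    using z0 by (auto simp: complex_eq_iff upper_half_plane_def)
  then have "C \<noteq> 0"
    by (simp add: C_def)
  have gF: "g u = C * F u" if "u \<in> ball 0 1" for u
    using slash_disc_matrix[OF z0, of u] that by (simp add: g_def C_def F_def M_def)
  have M_holo: "M holomorphic_on ball 0 1"
    unfolding M_def by (intro holomorphic_intros) auto
  have "f \<circ> M holomorphic_on ball 0 1"
    using disc_to_upper_half_plane[OF z0]
    by (intro holomorphic_on_compose_gen[OF M_holo f]) (auto simp: M_def)
  then have "(\<lambda>u. f (M u)) holomorphic_on ball 0 1"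
    by (simp add: o_def)
  then have F_holo: "F holomorphic_on ball 0 1"
    unfolding F_def by (intro holomorphic_intros) auto
  then have g_holo: "g holomorphic_on ball 0 1"
    by (subst holomorphic_cong[OF refl gF]) (auto intro: holomorphic_intros)
  \<comment> \<open>The definite description is resolved: Taylor expansion on the disc gives
    existence, \<open>power_series_coeffs_unique\<close> gives uniqueness.\<close>
  have "point_coeff k f z0 = (\<lambda>n. (deriv ^^ n) g 0 / fact n)"
    unfolding point_coeff_def g_def[symmetric]
  proof (rule the_equality)
    show "\<forall>z\<in>ball 0 1. (\<lambda>n. (deriv ^^ n) g 0 / fact n * z ^ n) sums g z"
      using holomorphic_power_series[OF g_holo] by simp
  next
    fix c assume "\<forall>z\<in>ball 0 1. (\<lambda>n. c n * z ^ n) sums g z"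
    then show "c = (\<lambda>n. (deriv ^^ n) g 0 / fact n)"
      using power_series_coeffs_unique[of 1 c g] by auto
  qed
  moreover have "(deriv ^^ n) g 0 = (deriv ^^ n) (\<lambda>u. C * F u) 0"
    using gF F_holo g_holo
    by (intro higher_deriv_transform_within_open[where S = "ball 0 1"] holomorphic_intros) auto
  moreover have "\<dots> = C * (deriv ^^ n) F 0"
    using F_holo by (intro higher_deriv_cmult[where A = "ball 0 1"]) auto
  moreover have "(deriv ^^ n) F 0 =
      (\<Sum>r\<le>n. disc_coeff k n r * (z0 - cnj z0) ^ r * (deriv ^^ r) f z0)"
    using higher_deriv_disc_expansion[OF f z0, of 0 n k] by (simp add: F_def M_def)
  moreover have "z0 - cnj z0 = 2 * \<i> * of_real (Im z0)"
    by (simp add: complex_eq_iff)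
  ultimately show ?thesis
    using \<open>C \<noteq> 0\<close> by (simp add: power_mult_distrib mult_ac)
qed

section \<open>Measure of the set of vanishing points\<close>

lemma negligible_point_coeff_zeros:
  assumes "cusp_form k f" "\<exists>z\<in>upper_half_plane. f z \<noteq> 0"
  shows "negligible {z \<in> upper_half_plane. point_coeff k f z n = 0}"
proof -
  have f: "f holomorphic_on upper_half_plane"
    using assms(1) by (simp add: cusp_form_def)
  obtain z1 where z1: "z1 \<in> upper_half_plane" "(deriv ^^ n) f z1 \<noteq> 0"
    using cusp_form_higher_deriv_nonzero[OF assms] by blast
  have "negligible {z \<in> upper_half_plane.
      (\<Sum>r\<le>n. disc_coeff k n r * (2 * \<i>) ^ r * (deriv ^^ r) f z * of_real (Im z) ^ r) = 0}"
  proof (rule negligible_zeros_polynomial_in_Im)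
    show "(\<lambda>z. disc_coeff k n r * (2 * \<i>) ^ r * (deriv ^^ r) f z) holomorphic_on upper_half_plane"
      for r
      by (intro holomorphic_intros holomorphic_higher_deriv[OF f] open_upper_half_plane)
    \<comment> \<open>The coefficient tested at \<open>z1\<close> is the leading one, that is,
      \<open>m = n\<close>.\<close>
    show "disc_coeff k n n * (2 * \<i>) ^ n * (deriv ^^ n) f z1 \<noteq> 0"
      using z1(2) by (simp add: disc_coeff_diag)
  qed (auto simp: open_upper_half_plane connected_upper_half_plane z1)
  then show ?thesis
    by (rule negligible_subset) (auto simp: point_coeff_eq_0_iff[OF f])
qed

theorem theorem1p5:
  fixes k :: int and f :: "complex \<Rightarrow> complex"
  assumes "even k"
    and "cusp_form k f"
    and "\<exists>z\<in>upper_half_plane. f z \<noteq> 0"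
  shows "ext_null_set (vanishing_points k f)"
proof -
  \<comment> \<open>A superset of the finite vanishing points: the zeros of the coefficients for all
    indices, a countable union, together with all finite cusps.\<close>
  have "negligible ((\<Union>n. {z \<in> upper_half_plane. point_coeff k f z n = 0}) \<union> \<rat>)"
    using negligible_point_coeff_zeros[OF assms(2,3)]
      null_sets_completionI[OF countable_imp_null_set_lborel[OF countable_rat]]
    by (intro negligible_Un negligible_Union_nat) (simp_all add: negligible_iff_null_sets)
  then have "negligible {z. Fin z \<in> vanishing_points k f}"
    by (rule negligible_subset) (auto simp: vanishing_points_def cusps_def)
  then show ?thesis
    by (simp add: ext_null_set_def negligible_iff_null_sets)
qed

end
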